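(* Let $D$ be a diagram of a nonsplit oriented link and let $\sigma$ be its all-1 state. Suppose that $\sigma$ is even. Then there are always two (distinct) nontrivial rational Khovanov homology classes represented by state cycles based on $\sigma$, namely: (i) the enhanced state based on $\sigma$ in which every loop is marked by $v_+$ is a state cycle representing a nontrivial homology class, and it is the unique state cycle based on $\sigma$ representing that class; (ii) for every choice of a loop $L$ of $\sigma$, the enhanced state $\alpha_L$ based on $\sigma$ in which $L$ is marked by $v_-$ and all other loops are marked by $v_+$ is a state cycle representing a nontrivial homology class, and up to sign this class does not depend on the choice of loop: $[\alpha_L]=\pm[\alpha_{L'}]$ for any two loops $L,L'$ of $\sigma$.
   Context: Khovanov complex (coefficients in $\mathbb{Q}$, unreduced). Let $D$ be a diagram of an oriented link with $m$ crossings in a fixed order, $n_+$ of them positive and $n_-$ negative. Each crossing has a 0-smoothing and a 1-smoothing (the standard convention, in which the smoothing consistent with orientation is the 0-smoothing at a positive crossing and the 1-smoothing at a negative crossing). A state $\sigma$ is a choice of smoothing at every crossing; it yields a collection of disjoint planar loops. The all-1 state is the state in which every crossing is 1-smoothed. An enhanced state based on $\sigma$ is a marking of each loop of $\sigma$ by $v_+$ or $v_-$. Let $C_\sigma$ be the rational vector space with basis the enhanced states based on $\sigma$ (i.e. $V^{\otimes(\text{number of loops})}$ with $V=\langle v_+,v_-\rangle$); the chain complex is $\bigoplus_\sigma C_\sigma$. Bigrading: for an enhanced state $\alpha$ based on $\sigma$, let $h(\sigma)$ be the number of 1-smoothings of $\sigma$, and $v_\pm(\alpha)$ the number of loops marked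 $v_\pm$. The homological grading is $t(\alpha)=h(\sigma)-n_-$ and the quantum grading is $q(\alpha)=v_+(\alpha)-v_-(\alpha)+h(\sigma)+n_+-2n_-$. Differential: for each 0-smoothed crossing of $\sigma$, let $\sigma'$ be the state obtained by changing it to a 1-smoothing; the edge differential $C_\sigma\to C_{\sigma'}$ is the identity on unchanged loops, and on changed loops it is the merge $v_+\otimes v_+\mapsto v_+$, $v_+\otimes v_-\mapsto v_-$, $v_-\otimes v_+\mapsto v_-$, $v_-\otimes v_-\mapsto 0$ if two loops become one, or the split $v_+\mapsto v_+\otimes v_-+v_-\otimes v_+$, $v_-\mapsto v_-\otimes v_-$ if one loop becomes two. The differential $d$ is the sum of all edge differentials, each multiplied by the standard sign $(-1)^{r}$, where $r$ is the number of 1-smoothed crossings of $\sigma$ preceding the changed crossing in the order. Khovanov homology is the homology of this complex. A state cycle is an enhanced state $\alpha$ with $d(\alpha)=0$; it is nontrivial if it represents a nonzero homology class. State graph: for each crossing, its trace in $\sigma$ is the arc recording where the crossing was smoothed; it joins the two (possibly equal) loops of $\sigma$ passing by that crossing. The state graph $\Gamma_\sigma$ has the loops of $\sigma$ as vertices and the traces as edges (self-loops and multiple edges allowed). The state $\sigma$ is even if every circuit (closed path) in $\Gamma_\sigma$ has even length (a trace from a loop to itself counts as a circuit of length 1). *)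

theory Defs
  imports Complex_Main "HOL-Library.Multiset" "HOL-Library.FuncSet" "HOL-Library.Poly_Mapping"
begin

section \<open>Diagrams of oriented links\<close>

text \<open>
  Oriented link diagrams are given by oriented planar diagram codes. The link is cut into
  oriented edges at its crossings; a crossing records whether it is positive and the pairs
  (incoming edge, outgoing edge) of its over-strand and of its under-strand. An edge of the
  diagram that occurs at no crossing is a closed component without crossings.
  The order of the crossings is their order in the list.
\<close>

datatype 'e crossing = Crossing (positive: bool) (over: "'e \<times> 'e") (under: "'e \<times> 'e")

datatype diagram = Diagram (edges: "nat set") (crossings: "nat crossing list")

definition heads :: "diagram \<Rightarrow> nat list" where
  "heads D = concat (map (\<lambda>x. [fst (over x), fst (under x)]) (crossings D))"

definition tails :: "diagram \<Rightarrow> nat list" where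
  "tails D = concat (map (\<lambda>x. [snd (over x), snd (under x)]) (crossings D))"

definition diagram_code :: "diagram \<Rightarrow> bool" where
  "diagram_code D \<longleftrightarrow> finite (edges D) \<and> edges D \<noteq> {} \<and>
     distinct (heads D) \<and> distinct (tails D) \<and>
     set (heads D) = set (tails D) \<and> set (heads D) \<subseteq> edges D"

text \<open>
  The four edge ends around a crossing in counterclockwise order, starting at the incoming
  under-edge; the flag tells whether the edge points away from the crossing. At a positive
  crossing the over-strand crosses from the left to the right of the under-strand.
\<close>

fun ends :: "'e crossing \<Rightarrow> ('e \<times> bool) list" where
  "ends (Crossing True (oi, oo) (ui, uo)) = [(ui, False), (oo, True), (uo, True), (oi, False)]"
| "ends (Crossing False (oi, oo) (ui, uo)) = [(ui, False), (oi, False), (uo, True), (oo, True)]"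

text \<open>The classes of \<open>A\<close> under the equivalence relation generated by \<open>R\<close>.\<close>

definition classes :: "'a set \<Rightarrow> ('a \<times> 'a) set \<Rightarrow> 'a set set" where
  "classes A R = A // (R \<union> R\<inverse>)\<^sup>*"

definition components :: "diagram \<Rightarrow> nat set set" where
  "components D = classes (edges D)
     (\<Union>x\<in>set (crossings D). (fst ` set (ends x)) \<times> (fst ` set (ends x)))"

text \<open>
  A side of an edge is a pair \<open>(e, True)\<close> (left of \<open>e\<close>) or \<open>(e, False)\<close> (right of \<open>e\<close>).
  The corner between two consecutive ends at a crossing joins the counterclockwise side of the
  first end (the left side iff the edge points away from the crossing) to the clockwise side
  of the second. The classes of sides so obtained are the boundary walks of the faces.
\<close>

definition corners :: "'e crossing \<Rightarrow> (('e \<times> bool) \<times> ('e \<times> bool)) set" where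
  "corners x = {((e, b), (e', \<not> b')) | e b e' b'.
     ((e, b), (e', b')) \<in> set (zip (ends x) (rotate1 (ends x)))}"

definition faces :: "diagram \<Rightarrow> (nat \<times> bool) set set" where
  "faces D = classes (edges D \<times> UNIV) (\<Union>x\<in>set (crossings D). corners x)"

text \<open>
  With \<open>V\<close> crossings there are \<open>2 * V\<close> edges at crossings, so for a connected diagram the
  condition below is Euler's formula \<open>V - 2 * V + F = 2\<close> (a circle without crossings has two
  sides and satisfies it as well). In general it says that every connected component of the
  diagram has genus 0. How these components lie in each other's faces is not recorded;
  it affects neither the link nor the circles of the smoothings.
\<close>

definition planar :: "diagram \<Rightarrow> bool" where
  "planar D \<longleftrightarrow> card (faces D) = length (crossings D) + 2 * card (components D)"

definition link_diagram :: "diagram \<Rightarrow> bool" where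
  "link_diagram D \<longleftrightarrow> diagram_code D \<and> planar D"


section \<open>Links and splitness\<close>

text \<open>
  \<open>identifies \<phi> A R\<close>: on \<open>A\<close>, the relabelling \<open>\<phi>\<close> identifies exactly the labels that the
  equivalence relation generated by \<open>R\<close> identifies.
\<close>

definition identifies :: "(nat \<Rightarrow> nat) \<Rightarrow> nat set \<Rightarrow> (nat \<times> nat) set \<Rightarrow> bool" where
  "identifies \<phi> A R \<longleftrightarrow> (\<forall>u\<in>A. \<forall>v\<in>A. \<phi> u = \<phi> v \<longleftrightarrow> (u, v) \<in> (R \<union> R\<inverse>)\<^sup>*)"

text \<open>
  For a strand passing through edges \<open>x\<close>, \<open>y\<close>, \<open>z\<close> in this order, its first
  (\<open>pass True\<close>) or second (\<open>pass False\<close>) passage through a crossing.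
\<close>

fun pass :: "bool \<Rightarrow> 'e \<times> 'e \<times> 'e \<Rightarrow> 'e \<times> 'e" where
  "pass True (x, y, z) = (x, y)"
| "pass False (x, y, z) = (y, z)"

text \<open>
  Three strands \<open>t\<close>, \<open>m\<close>, \<open>b\<close> (top, middle, bottom), any two of which cross once; \<open>p\<close>: \<open>t\<close>
  meets \<open>m\<close> before \<open>b\<close>; \<open>q\<close>: \<open>m\<close> meets \<open>t\<close> before \<open>b\<close>; \<open>r\<close>: \<open>b\<close> meets \<open>t\<close> before \<open>m\<close>.
\<close>

definition three_strands ::
  "bool \<Rightarrow> bool \<Rightarrow> bool \<Rightarrow> bool \<Rightarrow> bool \<Rightarrow> bool \<Rightarrow>
   'e \<times> 'e \<times> 'e \<Rightarrow> 'e \<times> 'e \<times> 'e \<Rightarrow> 'e \<times> 'e \<times> 'e \<Rightarrow> 'e crossing list" where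
  "three_strands s1 s2 s3 p q r t m b =
     [Crossing s1 (pass p t) (pass q m),
      Crossing s2 (pass (\<not> p) t) (pass r b),
      Crossing s3 (pass (\<not> q) m) (pass (\<not> r) b)]"

text \<open>
  Renaming of edges together with reordering of crossings, and the oriented Reidemeister moves.
  The moves I and II are stated in the direction that removes crossings. Their outer edges may
  coincide, in which case closed components without crossings can arise. In move II, \<open>b\<close> and
  \<open>y\<close> bound a bigon; in move III the three middle edges bound a triangle.
\<close>

inductive reidemeister_move :: "diagram \<Rightarrow> diagram \<Rightarrow> bool" where
  rename: "\<lbrakk>identifies \<phi> E {}; mset ys = mset (map (map_crossing \<phi>) xs)\<rbrakk>
    \<Longrightarrow> reidemeister_move (Diagram E xs) (Diagram (\<phi> ` E) ys)"
| move1: "identifies \<phi> (E - {f}) {(e, g)}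
    \<Longrightarrow> reidemeister_move
          (Diagram E (Crossing s (pass p (e, f, g)) (pass (\<not> p) (e, f, g)) # xs))
          (Diagram (\<phi> ` (E - {f})) (map (map_crossing \<phi>) xs))"
| move2: "\<lbrakk>D = Diagram E (Crossing s (a, b) (pass p (x, y, z)) #
                     Crossing (\<not> s) (b, c) (pass (\<not> p) (x, y, z)) # xs);
      {(b, i), (y, j)} \<in> faces D;
      identifies \<phi> (E - {b, y}) {(a, c), (x, z)}\<rbrakk>
    \<Longrightarrow> reidemeister_move D (Diagram (\<phi> ` (E - {b, y})) (map (map_crossing \<phi>) xs))"
| move3: "\<lbrakk>D = Diagram E (three_strands s1 s2 s3 p q r (t1, t2, t3) (m1, m2, m3) (b1, b2, b3) @ xs);
      {(t2, i), (m2, j), (b2, k)} \<in> faces D\<rbrakk>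
    \<Longrightarrow> reidemeister_move D
          (Diagram E (three_strands s1 s2 s3 (\<not> p) (\<not> q) (\<not> r)
             (t1, t2, t3) (m1, m2, m3) (b1, b2, b3) @ xs))"

definition same_link :: "diagram \<Rightarrow> diagram \<Rightarrow> bool" where
  "same_link = equivclp (\<lambda>D D'. link_diagram D \<and> link_diagram D' \<and> reidemeister_move D D')"

text \<open>A link is split iff it has a disconnected diagram.\<close>

definition nonsplit :: "diagram \<Rightarrow> bool" where
  "nonsplit D \<longleftrightarrow> \<not> (\<exists>D'. same_link D D' \<and> card (components D') > 1)"


section \<open>States and the state graph\<close>

text \<open>
  The pairs of ends joined by the two arcs of a smoothing (\<open>True\<close>: 1-smoothing). The
  0-smoothing is the oriented one at positive crossings, the 1-smoothing at negative ones.
\<close>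

definition smoothing :: "bool \<Rightarrow> 'e crossing \<Rightarrow> ('e \<times> 'e) set" where
  "smoothing one x = (let es = map fst (ends x) in
     if one then {(es ! 0, es ! 3), (es ! 1, es ! 2)} else {(es ! 0, es ! 1), (es ! 2, es ! 3)})"

text \<open>A state is the set of (positions of) its 1-smoothed crossings.\<close>

type_synonym state = "nat set"

definition states :: "diagram \<Rightarrow> state set" where
  "states D = Pow {..<length (crossings D)}"

definition all_one :: "diagram \<Rightarrow> state" where
  "all_one D = {..<length (crossings D)}"

text \<open>A loop is represented by the set of the edges it traverses.\<close>

definition loops :: "diagram \<Rightarrow> state \<Rightarrow> nat set set" where
  "loops D S = classes (edges D)
     (\<Union>i<length (crossings D). smoothing (i \<in> S) (crossings D ! i))"

text \<open>The endpoints of the trace of crossing \<open>i\<close>: a set of two loops, or of one if it is a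
  self-loop of the state graph.\<close>

definition trace :: "diagram \<Rightarrow> state \<Rightarrow> nat \<Rightarrow> nat set set" where
  "trace D S i = {L \<in> loops D S. \<exists>(a, b) \<in> smoothing (i \<in> S) (crossings D ! i). a \<in> L}"

inductive state_graph_walk :: "diagram \<Rightarrow> state \<Rightarrow> nat set \<Rightarrow> nat list \<Rightarrow> nat set \<Rightarrow> bool"
  for D S where
  "L \<in> loops D S \<Longrightarrow> state_graph_walk D S L [] L"
| "\<lbrakk>i < length (crossings D); trace D S i = {L, L'}; state_graph_walk D S L' is L''\<rbrakk>
    \<Longrightarrow> state_graph_walk D S L (i # is) L''"

definition circuit :: "diagram \<Rightarrow> state \<Rightarrow> nat list \<Rightarrow> bool" where
  "circuit D S is \<longleftrightarrow> distinct is \<and> (\<exists>L. state_graph_walk D S L is L)"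

definition even_state :: "diagram \<Rightarrow> state \<Rightarrow> bool" where
  "even_state D S \<longleftrightarrow> (\<forall>is. circuit D S is \<longrightarrow> even (length is))"


section \<open>The Khovanov complex\<close>

datatype mark = Plus | Minus

type_synonym enhanced_state = "state \<times> (nat set \<Rightarrow> mark)"

definition enhanced_states :: "diagram \<Rightarrow> enhanced_state set" where
  "enhanced_states D = (SIGMA S:states D. loops D S \<rightarrow>\<^sub>E UNIV)"

text \<open>
  The chain complex is the space of rational combinations of enhanced states of \<open>D\<close>. Homology
  is taken of this total complex, i.e. it is the direct sum over all bidegrees.
\<close>

type_synonym chain = "enhanced_state \<Rightarrow>\<^sub>0 rat"

definition chains :: "diagram \<Rightarrow> chain set" where
  "chains D = {x. Poly_Mapping.keys x \<subseteq> enhanced_states D}"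

abbreviation basis :: "enhanced_state \<Rightarrow> chain" where
  "basis \<alpha> \<equiv> Poly_Mapping.single \<alpha> 1"

text \<open>
  The edge differential from \<open>S\<close> to \<open>S'\<close>. All its matrix entries are 0 or 1;
  \<open>edge_entry D S a S' b\<close> says that the entry from \<open>(S, a)\<close> to \<open>(S', b)\<close> is 1.
\<close>

definition merge_entry :: "diagram \<Rightarrow> state \<Rightarrow> (nat set \<Rightarrow> mark) \<Rightarrow> state \<Rightarrow> (nat set \<Rightarrow> mark) \<Rightarrow> bool"
where
  "merge_entry D S a S' b \<longleftrightarrow>
     (\<exists>x y z. x \<noteq> y \<and> loops D S - loops D S' = {x, y} \<and> loops D S' - loops D S = {z} \<and>
        (a x, a y, b z) \<in> {(Plus, Plus, Plus), (Plus, Minus, Minus), (Minus, Plus, Minus)})"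

definition split_entry :: "diagram \<Rightarrow> state \<Rightarrow> (nat set \<Rightarrow> mark) \<Rightarrow> state \<Rightarrow> (nat set \<Rightarrow> mark) \<Rightarrow> bool"
where
  "split_entry D S a S' b \<longleftrightarrow>
     (\<exists>x y z. y \<noteq> z \<and> loops D S - loops D S' = {x} \<and> loops D S' - loops D S = {y, z} \<and>
        (a x, b y, b z) \<in> {(Plus, Plus, Minus), (Plus, Minus, Plus), (Minus, Minus, Minus)})"

definition edge_entry :: "diagram \<Rightarrow> state \<Rightarrow> (nat set \<Rightarrow> mark) \<Rightarrow> state \<Rightarrow> (nat set \<Rightarrow> mark) \<Rightarrow> bool"
where
  "edge_entry D S a S' b \<longleftrightarrow>
     (\<forall>L \<in> loops D S \<inter> loops D S'. a L = b L) \<and>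
     (merge_entry D S a S' b \<or> split_entry D S a S' b)"

definition kh_diff_basis :: "diagram \<Rightarrow> enhanced_state \<Rightarrow> chain" where
  "kh_diff_basis D = (\<lambda>(S, a).
     \<Sum>i \<in> {..<length (crossings D)} - S. \<Sum>b \<in> loops D (insert i S) \<rightarrow>\<^sub>E UNIV.
       Poly_Mapping.single (insert i S, b)
         ((- 1) ^ card {j \<in> S. j < i} * of_bool (edge_entry D S a (insert i S) b)))"

definition kh_diff :: "diagram \<Rightarrow> chain \<Rightarrow> chain" where
  "kh_diff D x = (\<Sum>\<alpha>\<in>Poly_Mapping.keys x.
     Poly_Mapping.map ((*) (Poly_Mapping.lookup x \<alpha>)) (kh_diff_basis D \<alpha>))"

definition cycles :: "diagram \<Rightarrow> chain set" where
  "cycles D = {z \<in> chains D. kh_diff D z = 0}"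

definition boundaries :: "diagram \<Rightarrow> chain set" where
  "boundaries D = kh_diff D ` chains D"

definition homologous :: "diagram \<Rightarrow> (chain \<times> chain) set" where
  "homologous D = {(z, w). z \<in> cycles D \<and> w \<in> cycles D \<and> z - w \<in> boundaries D}"

text \<open>Khovanov homology is \<open>cycles D // homologous D\<close>; this is the class of the cycle \<open>z\<close>.\<close>

definition kh_class :: "diagram \<Rightarrow> chain \<Rightarrow> chain set" where
  "kh_class D z = homologous D `` {z}"

definition state_cycle :: "diagram \<Rightarrow> state \<Rightarrow> enhanced_state \<Rightarrow> bool" where
  "state_cycle D S \<alpha> \<longleftrightarrow> \<alpha> \<in> enhanced_states D \<and> fst \<alpha> = S \<and> kh_diff D (basis \<alpha>) = 0"

definition nontrivial :: "diagram \<Rightarrow> enhanced_state \<Rightarrow> bool" where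
  "nontrivial D \<alpha> \<longleftrightarrow> kh_class D (basis \<alpha>) \<noteq> kh_class D 0"

definition all_plus :: "diagram \<Rightarrow> state \<Rightarrow> enhanced_state" where
  "all_plus D S = (S, \<lambda>L\<in>loops D S. Plus)"

definition one_minus :: "diagram \<Rightarrow> state \<Rightarrow> nat set \<Rightarrow> enhanced_state" where
  "one_minus D S L = (S, \<lambda>L'\<in>loops D S. if L' = L then Minus else Plus)"

end

theory Submission
  imports Defs
begin

text \<open>
  No crossing of the all-1 state is 0-smoothed, so the differential vanishes on all its enhanced
  states, and only the image of the differential matters. The part of this image that lies in the
  all-1 state comes from the states with a single 0-smoothed crossing. Evenness excludes
  self-loops of the state graph, so the trace of the crossing joins two distinct loops \<open>L\<close> and \<open>M\<close>
  of the all-1 state, and the edge map splits \<open>L \<union> M\<close> into them (\<open>edge_entry_all_one\<close>).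

  Each term of a split contains a minus sign. So the all-plus state has coefficient 0 in every
  boundary (\<open>lookup_boundary_all_plus\<close>), and it is neither a boundary nor homologous to another
  enhanced state.

  Let \<open>\<alpha>\<^sub>L\<close> be the state with a minus sign at \<open>L\<close> only. By evenness the state graph is bipartite
  (\<open>two_colouring\<close>). In the image of a split, \<open>\<alpha>\<^sub>L\<close> and \<open>\<alpha>\<^sub>M\<close> have equal coefficients, and no other
  state with a single minus sign occurs; since \<open>L\<close> and \<open>M\<close> have opposite colours, the sum of the
  coefficients of the \<open>\<alpha>\<^sub>K\<close>, weighted by the colours \<open>\<plusminus>1\<close> of the \<open>K\<close>, vanishes on boundaries
  (\<open>alternating_sum_boundary\<close>). It is \<open>\<plusminus>1\<close> on \<open>\<alpha>\<^sub>L\<close>, so \<open>\<alpha>\<^sub>L\<close> is not a boundary. Finally the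
  split of an all-plus state is \<open>\<plusminus>(\<alpha>\<^sub>L + \<alpha>\<^sub>M)\<close> (\<open>one_minus_adjacent\<close>), and the state graph is
  connected because the diagram of a nonsplit link is (\<open>walk_exists\<close>); so all \<open>[\<alpha>\<^sub>L]\<close> agree up to
  sign.

  Loops are classes of edges rather than curves, so the fact that resmoothing a crossing with two
  distinct loops merges them needs a proof (\<open>loops_Diff_crossing\<close>). It rests on a parity count:
  every edge at a crossing has exactly two ends.
\<close>

section \<open>Classes of a generated equivalence relation\<close>

text \<open>The equivalence relation generated by \<open>R\<close>, and the class of \<open>u\<close>.\<close>

abbreviation conn :: "('a \<times> 'a) set \<Rightarrow> ('a \<times> 'a) set" where
  "conn R \<equiv> (R \<union> R\<inverse>)\<^sup>*"

abbreviation cls :: "('a \<times> 'a) set \<Rightarrow> 'a \<Rightarrow> 'a set" where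
  "cls R u \<equiv> conn R `` {u}"

lemma equiv_conn: "equiv UNIV (conn R)"
  by (intro equivI refl_rtrancl trans_rtrancl sym_rtrancl) (auto simp: sym_Un_converse)

lemma cls_eq_iff: "cls R u = cls R v \<longleftrightarrow> (u, v) \<in> conn R"
  using eq_equiv_class_iff[OF equiv_conn, of u v R] by simp

lemma conn_sym: "(u, v) \<in> conn R \<Longrightarrow> (v, u) \<in> conn R"
  by (metis cls_eq_iff)

lemma cls_subset_closed:
  assumes "u \<in> X" and "\<And>a b. (a, b) \<in> R \<Longrightarrow> a \<in> X \<longleftrightarrow> b \<in> X"
  shows "cls R u \<subseteq> X"
proof
  fix v assume "v \<in> cls R u"
  then have "(u, v) \<in> conn R" by simp
  then show "v \<in> X" using assms by induction auto
qed

lemma cls_closed: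
  assumes "(a, b) \<in> conn R" shows "a \<in> cls R u \<longleftrightarrow> b \<in> cls R u"
  using assms by (metis Image_singleton_iff cls_eq_iff)

lemma cls_closed_step: "(a, b) \<in> R \<Longrightarrow> a \<in> cls R u \<longleftrightarrow> b \<in> cls R u"
  by (rule cls_closed) auto

lemma conn_least:
  assumes "R \<subseteq> conn R'" shows "conn R \<subseteq> conn R'"
proof -
  have "R \<union> R\<inverse> \<subseteq> conn R'" using assms conn_sym by fastforce
  then show ?thesis by (rule rtrancl_subset_rtrancl)
qed

lemma conn_mono: "R \<subseteq> R' \<Longrightarrow> conn R \<subseteq> conn R'"
  by (intro conn_least) auto

lemma conn_Un_absorb:
  assumes "Q \<subseteq> conn R" shows "conn (R \<union> Q) = conn R"
  using assms by (intro equalityI conn_least conn_mono) auto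

text \<open>Joining two points merges their classes and leaves the other classes alone.\<close>

lemma cls_insert:
  "cls (insert (u, v) R) w =
     (if w \<in> cls R u \<union> cls R v then cls R u \<union> cls R v else cls R w)"
proof -
  let ?Q = "insert (u, v) R"
  have mono: "cls R z \<subseteq> cls ?Q z" for z
    using conn_mono[of R ?Q] by auto
  have uv: "cls ?Q u = cls ?Q v" by (subst cls_eq_iff) auto
  show ?thesis
  proof (cases "w \<in> cls R u \<union> cls R v")
    case True
    have "cls ?Q w \<subseteq> cls R u \<union> cls R v"
      using True by (rule cls_subset_closed) (use cls_closed_step[of _ _ R] in blast)+
    moreover have "cls ?Q w = cls ?Q u"
    proof -
      have "w \<in> cls ?Q u" using True mono[of u] mono[of v] uv by blast
      then show ?thesis by (metis Image_singleton_iff cls_eq_iff)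
    qed
    ultimately show ?thesis using True mono[of u] mono[of v] uv by auto
  next
    case False
    then have "u \<notin> cls R w" "v \<notin> cls R w" using conn_sym by fastforce+
    then have "cls ?Q w \<subseteq> cls R w"
      by (intro cls_subset_closed) (use cls_closed_step[of _ _ R w] in blast)+
    then show ?thesis using False mono[of w] by auto
  qed
qed

lemma classes_alt: "classes A R = cls R ` A"
  by (auto simp: classes_def quotient_def)

lemma classes_insert:
  assumes "u \<in> A"
  shows "classes A (insert (u, v) R) =
    insert (cls R u \<union> cls R v) (classes A R - {cls R u, cls R v})"
proof -
  have "w \<in> cls R u \<union> cls R v \<longleftrightarrow> cls R w \<in> {cls R u, cls R v}" for w
    using cls_eq_iff[of R u w] cls_eq_iff[of R v w] by auto
  moreover have "u \<in> cls R u \<union> cls R v" by auto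
  ultimately show ?thesis
    using assms unfolding classes_alt cls_insert by (auto simp: image_iff)
qed

lemma classes_disjoint:
  assumes "C \<in> classes A R" "C' \<in> classes A R" "u \<in> C" "u \<in> C'"
  shows "C = C'"
  using assms unfolding classes_alt by (metis (no_types, lifting) Image_singleton_iff cls_eq_iff imageE)


section \<open>Loops of a state\<close>

text \<open>The pairs of edges joined by the arcs of the smoothings of the state \<open>S\<close>.\<close>

definition joins :: "diagram \<Rightarrow> state \<Rightarrow> (nat \<times> nat) set" where
  "joins D S = (\<Union>i<length (crossings D). smoothing (i \<in> S) (crossings D ! i))"

text \<open>The loop of the state \<open>S\<close> that traverses the edge \<open>e\<close>.\<close>

abbreviation loop_at :: "diagram \<Rightarrow> state \<Rightarrow> nat \<Rightarrow> nat set" where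
  "loop_at D S e \<equiv> cls (joins D S) e"

text \<open>The edges at the four ends of a crossing, in counterclockwise order.\<close>

definition end_edge :: "'e crossing \<Rightarrow> nat \<Rightarrow> 'e" where
  "end_edge x k = fst (ends x ! k)"

lemma map_fst_ends:
  "map fst (ends x) = [end_edge x 0, end_edge x 1, end_edge x 2, end_edge x 3]"
  by (cases x rule: ends.cases) (auto simp: end_edge_def numeral_eq_Suc)

lemma smoothing_simps:
  "smoothing True x = {(end_edge x 0, end_edge x 3), (end_edge x 1, end_edge x 2)}"
  "smoothing False x = {(end_edge x 0, end_edge x 1), (end_edge x 2, end_edge x 3)}"
  by (simp_all add: smoothing_def map_fst_ends numeral_eq_Suc)

lemma fst_ends: "fst ` set (ends x) = {end_edge x 0, end_edge x 1, end_edge x 2, end_edge x 3}"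
  by (metis list.set_map map_fst_ends list.simps(15) empty_set)

lemma fst_ends_over_under:
  "fst ` set (ends x) = {fst (over x), fst (under x), snd (over x), snd (under x)}"
  by (cases x rule: ends.cases) auto

lemma end_edge_in_edges:
  assumes "diagram_code D" "x \<in> set (crossings D)" "e \<in> fst ` set (ends x)"
  shows "e \<in> edges D"
proof -
  have "e \<in> set (heads D) \<union> set (tails D)"
    using assms(2,3) unfolding fst_ends_over_under heads_def tails_def by auto
  then show ?thesis using assms(1) by (auto simp: diagram_code_def)
qed

lemma end_edges_in_edges:
  assumes "diagram_code D" "i < length (crossings D)"
  shows "end_edge (crossings D ! i) 0 \<in> edges D" "end_edge (crossings D ! i) 1 \<in> edges D"
    "end_edge (crossings D ! i) 2 \<in> edges D" "end_edge (crossings D ! i) 3 \<in> edges D"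
  using end_edge_in_edges[OF assms(1) nth_mem[OF assms(2)]] unfolding fst_ends by blast+

lemma loops_alt: "loops D S = loop_at D S ` edges D"
  unfolding loops_def joins_def[symmetric] classes_alt ..

lemma loop_at_in_loops: "e \<in> edges D \<Longrightarrow> loop_at D S e \<in> loops D S"
  by (simp add: loops_alt)

lemma loops_disjoint:
  "\<lbrakk>C \<in> loops D S; C' \<in> loops D S; u \<in> C; u \<in> C'\<rbrakk> \<Longrightarrow> C = C'"
  unfolding loops_def by (rule classes_disjoint)

lemma loop_eqI:
  assumes "C \<in> loops D S" "u \<in> C" shows "C = loop_at D S u"
proof -
  obtain e where "C = loop_at D S e" using assms(1) unfolding loops_alt by blast
  with assms(2) show ?thesis by (simp only: cls_eq_iff Image_singleton_iff)
qed

lemma finite_loops: "diagram_code D \<Longrightarrow> finite (loops D S)"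
  by (simp add: loops_alt diagram_code_def)

lemma sum_list_concat_map: "sum_list (concat (map f xs)) = (\<Sum>x\<leftarrow>xs. sum_list (f x))"
  by (induction xs) auto

text \<open>
  Every edge that meets a crossing has exactly two ends, its head and its tail. So any set of
  edges meets the crossings in an even number of ends.
\<close>

lemma even_ends:
  assumes "diagram_code D"
  shows "even (\<Sum>x\<leftarrow>crossings D. \<Sum>e\<leftarrow>map fst (ends x). of_bool (e \<in> A) :: nat)"
proof -
  let ?c = "\<lambda>e. of_bool (e \<in> A) :: nat"
  have x: "(\<Sum>e\<leftarrow>map fst (ends x). ?c e) =
      (\<Sum>e\<leftarrow>[fst (over x), fst (under x)]. ?c e) + (\<Sum>e\<leftarrow>[snd (over x), snd (under x)]. ?c e)" for x
    by (cases x rule: ends.cases) auto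
  have "(\<Sum>x\<leftarrow>crossings D. \<Sum>e\<leftarrow>map fst (ends x). ?c e) =
      (\<Sum>e\<leftarrow>heads D. ?c e) + (\<Sum>e\<leftarrow>tails D. ?c e)"
    unfolding x heads_def tails_def sum_list_addf
    by (simp add: map_concat comp_def sum_list_concat_map)
  also have "\<dots> = (\<Sum>e\<in>set (heads D). ?c e) + (\<Sum>e\<in>set (tails D). ?c e)"
    using assms by (simp add: diagram_code_def sum_list_distinct_conv_sum_set)
  also have "\<dots> = 2 * (\<Sum>e\<in>set (heads D). ?c e)"
    using assms by (simp add: diagram_code_def)
  finally show ?thesis by simp
qed

text \<open>
  Hence a set of edges that is closed under the arcs at all crossings but one has an even number
  of ends at this crossing as well. This says that a loop stays connected when it is cut at one
  place.
\<close>

lemma even_ends_at_crossing: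
  assumes D: "diagram_code D" and i: "i < length (crossings D)"
    and closed: "\<And>j a b. \<lbrakk>j < length (crossings D); j \<noteq> i;
      (a, b) \<in> smoothing (j \<in> S) (crossings D ! j)\<rbrakk> \<Longrightarrow> a \<in> A \<longleftrightarrow> b \<in> A"
  shows "even (\<Sum>e\<leftarrow>map fst (ends (crossings D ! i)). of_bool (e \<in> A) :: nat)"
proof -
  define c where "c j = (\<Sum>e\<leftarrow>map fst (ends (crossings D ! j)). of_bool (e \<in> A) :: nat)" for j
  have "even (c j)" if "j < length (crossings D)" "j \<noteq> i" for j
    using closed[OF that]
    by (cases "j \<in> S") (auto simp: c_def map_fst_ends smoothing_simps)
  then have "even (\<Sum>j\<in>{..<length (crossings D)} - {i}. c j)"
    by (intro dvd_sum) auto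
  moreover have "even (\<Sum>j<length (crossings D). c j)"
    using even_ends[OF D, of A] unfolding sum_list_sum_nth c_def by (simp add: atLeast0LessThan)
  moreover have "(\<Sum>j<length (crossings D). c j) =
      c i + (\<Sum>j\<in>{..<length (crossings D)} - {i}. c j)"
    using i by (intro sum.remove) auto
  ultimately show ?thesis by (simp add: c_def)
qed

text \<open>
  If the two arcs of a 1-smoothed crossing lie on different loops, then 0-smoothing the crossing
  merges these loops: after both arcs are removed, each loop is a connected path, and the new
  arcs join the two paths.
\<close>

lemma loops_Diff_crossing:
  assumes D: "diagram_code D" and i: "i < length (crossings D)" "i \<in> S"
  defines "L \<equiv> loop_at D S (end_edge (crossings D ! i) 0)"
    and "M \<equiv> loop_at D S (end_edge (crossings D ! i) 1)"
  assumes ne: "L \<noteq> M"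
  shows "loops D (S - {i}) = insert (L \<union> M) (loops D S - {L, M})"
proof -
  let ?n = "length (crossings D)" and ?e = "end_edge (crossings D ! i)"
  \<comment> \<open>The arcs at the other crossings, which are common to both states.\<close>
  define P where "P = (\<Union>j\<in>{..<?n} - {i}. smoothing (j \<in> S) (crossings D ! j))"
  have split: "(\<Union>j<?n. f j) = (\<Union>j\<in>{..<?n} - {i}. f j) \<union> f i" for f :: "nat \<Rightarrow> (nat \<times> nat) set"
    using i by auto
  have J1: "joins D S = P \<union> {(?e 0, ?e 3), (?e 1, ?e 2)}"
    using i unfolding joins_def P_def split by (simp add: smoothing_simps)
  have J0: "joins D (S - {i}) = P \<union> {(?e 0, ?e 1), (?e 2, ?e 3)}"
    using i unfolding joins_def P_def split by (simp add: smoothing_simps)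
  have disj: "a \<notin> L \<or> a \<notin> M" for a
    using ne unfolding L_def M_def by (metis Image_singleton_iff cls_eq_iff)
  have inL: "?e 0 \<in> L" "?e 3 \<in> L" and inM: "?e 1 \<in> M" "?e 2 \<in> M"
    unfolding L_def M_def J1 by auto
  have sub: "cls P a \<subseteq> loop_at D S a" for a
    using conn_mono[of P "joins D S"] J1 by auto
  have even: "even (\<Sum>e\<leftarrow>map fst (ends (crossings D ! i)). of_bool (e \<in> cls P a) :: nat)" for a
  proof (rule even_ends_at_crossing[OF D i(1)])
    fix j b c
    assume "j < ?n" "j \<noteq> i" "(b, c) \<in> smoothing (j \<in> S) (crossings D ! j)"
    then have "(b, c) \<in> conn P" unfolding P_def by blast
    then show "b \<in> cls P a \<longleftrightarrow> c \<in> cls P a" by (rule cls_closed)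
  qed
  have "?e 1 \<notin> cls P (?e 0)" "?e 2 \<notin> cls P (?e 0)"
    using sub[of "?e 0"] inM disj unfolding L_def by blast+
  with even[of "?e 0"] have "?e 3 \<in> cls P (?e 0)"
    by (auto simp: map_fst_ends split: if_splits)
  then have e03: "(?e 0, ?e 3) \<in> conn P" by simp
  have "?e 0 \<notin> cls P (?e 1)" "?e 3 \<notin> cls P (?e 1)"
    using sub[of "?e 1"] inL disj unfolding M_def by blast+
  with even[of "?e 1"] have "?e 2 \<in> cls P (?e 1)"
    by (auto simp: map_fst_ends split: if_splits)
  then have e12: "(?e 1, ?e 2) \<in> conn P" by simp
  have c1: "conn (joins D S) = conn P"
    unfolding J1 using e03 e12 by (intro conn_Un_absorb) auto
  have c0: "conn (joins D (S - {i})) = conn (insert (?e 0, ?e 1) P)"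
  proof -
    have "conn P \<subseteq> conn (insert (?e 0, ?e 1) P)" by (intro conn_mono) auto
    then have "(?e 0, ?e 1) \<in> conn (insert (?e 0, ?e 1) P)"
      "(?e 0, ?e 3) \<in> conn (insert (?e 0, ?e 1) P)" "(?e 1, ?e 2) \<in> conn (insert (?e 0, ?e 1) P)"
      using e03 e12 by auto
    then have "(?e 2, ?e 3) \<in> conn (insert (?e 0, ?e 1) P)"
      by (metis cls_eq_iff)
    then have "conn (insert (?e 0, ?e 1) P \<union> {(?e 2, ?e 3)}) = conn (insert (?e 0, ?e 1) P)"
      by (intro conn_Un_absorb) auto
    moreover have "insert (?e 0, ?e 1) P \<union> {(?e 2, ?e 3)} = joins D (S - {i})"
      unfolding J0 by auto
    ultimately show ?thesis by metis
  qed
  have "loops D (S - {i}) = classes (edges D) (insert (?e 0, ?e 1) P)"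
    unfolding loops_alt classes_alt c0 ..
  also have "\<dots> = insert (L \<union> M) (classes (edges D) P - {L, M})"
    using classes_insert[OF end_edges_in_edges(1)[OF D i(1)], of "?e 1" P]
    unfolding L_def M_def c1 .
  also have "classes (edges D) P = loops D S"
    unfolding loops_alt classes_alt c1 ..
  finally show ?thesis .
qed


section \<open>The state graph\<close>

lemma walk_in_loops:
  "state_graph_walk D S L is L' \<Longrightarrow> L \<in> loops D S \<and> L' \<in> loops D S"
  by (induction rule: state_graph_walk.induct) (auto simp: trace_def)

lemma walk_append:
  "\<lbrakk>state_graph_walk D S L is L'; state_graph_walk D S L' js L''\<rbrakk>
    \<Longrightarrow> state_graph_walk D S L (is @ js) L''"
  by (induction rule: state_graph_walk.induct) (auto intro: state_graph_walk.intros)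

lemma walk_appendE:
  assumes "state_graph_walk D S L (is @ js) L''"
  obtains L' where "state_graph_walk D S L is L'" "state_graph_walk D S L' js L''"
  using assms
proof (induction "is" arbitrary: L thesis)
  case Nil
  then show ?case using walk_in_loops state_graph_walk.intros(1) by (metis append_Nil)
next
  case (Cons i "is")
  from Cons.prems(2) obtain M where M: "i < length (crossings D)" "trace D S i = {L, M}"
    "state_graph_walk D S M (is @ js) L''"
    by (auto elim: state_graph_walk.cases)
  from Cons.IH[OF _ M(3)] obtain L' where "state_graph_walk D S M is L'" "state_graph_walk D S L' js L''"
    by blast
  then show ?case using Cons.prems(1) M state_graph_walk.intros(2) by metis
qed

lemma walk_single:
  "state_graph_walk D S L [i] L' \<longleftrightarrow> i < length (crossings D) \<and> trace D S i = {L, L'}"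
proof
  assume "state_graph_walk D S L [i] L'"
  then show "i < length (crossings D) \<and> trace D S i = {L, L'}"
    by (auto elim!: state_graph_walk.cases[of _ _ _ "[i]"] elim: state_graph_walk.cases)
next
  assume *: "i < length (crossings D) \<and> trace D S i = {L, L'}"
  then have "L' \<in> loops D S" by (auto simp: trace_def)
  with * show "state_graph_walk D S L [i] L'" by (auto intro: state_graph_walk.intros)
qed

lemma walk_rev: "state_graph_walk D S L is L' \<Longrightarrow> state_graph_walk D S L' (rev is) L"
proof (induction rule: state_graph_walk.induct)
  case (1 L)
  then show ?case by (auto intro: state_graph_walk.intros)
next
  case (2 i L L' "is" L'')
  then have "state_graph_walk D S L' [i] L" by (simp add: walk_single insert_commute)
  with 2 show ?case by (auto intro: walk_append)
qed

text \<open>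
  Evenness speaks of closed walks without repeated traces. It carries over to all closed walks,
  since a closed walk that repeats a trace decomposes into two shorter closed walks, up to the
  repeated trace traversed back and forth.
\<close>

lemma even_closed_walk:
  assumes ev: "even_state D S"
  shows "state_graph_walk D S L is L \<Longrightarrow> even (length is)"
proof (induction "length is" arbitrary: L "is" rule: less_induct)
  case less
  show ?case
  proof (cases "distinct is")
    case True
    then show ?thesis using ev less.prems by (auto simp: even_state_def circuit_def)
  next
    case False
    then obtain xs y ys zs where is_eq: "is = xs @ [y] @ ys @ [y] @ zs"
      using not_distinct_decomp by blast
    obtain u v u' v' where w: "state_graph_walk D S L xs u" "state_graph_walk D S u [y] v"
      "state_graph_walk D S v ys u'" "state_graph_walk D S u' [y] v'" "state_graph_walk D S v' zs L"
      using less.prems unfolding is_eq by (elim walk_appendE) auto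
    then have "{u, v} = {u', v'}" by (simp add: walk_single)
    then consider "u' = u" "v' = v" | "u' = v" "v' = u" by (auto simp: doubleton_eq_iff)
    then show ?thesis
    proof cases
      case 1
      have "even (length ([y] @ ys))" "even (length (xs @ [y] @ zs))"
        using w 1 by (intro less.hyps; simp add: is_eq; blast intro: walk_append[of _ _ _ "[y]", simplified] walk_append)+
      then show ?thesis by (simp add: is_eq)
    next
      case 2
      have "even (length ys)" "even (length (xs @ zs))"
        using w 2 by (intro less.hyps; simp add: is_eq; blast intro: walk_append)+
      then show ?thesis by (simp add: is_eq)
    qed
  qed
qed

lemma trace_all_one_smoothed:
  assumes D: "diagram_code D" and i: "i < length (crossings D)" "i \<in> S"
  shows "trace D S i = {loop_at D S (end_edge (crossings D ! i) 0),
                        loop_at D S (end_edge (crossings D ! i) 1)}"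
proof -
  have "trace D S i = {L \<in> loops D S. end_edge (crossings D ! i) 0 \<in> L \<or> end_edge (crossings D ! i) 1 \<in> L}"
    using i unfolding trace_def by (auto simp: smoothing_simps)
  also have "\<dots> = {loop_at D S (end_edge (crossings D ! i) 0),
      loop_at D S (end_edge (crossings D ! i) 1)}" (is "?T = {?L, ?M}")
  proof (intro equalityI subsetI)
    fix C assume "C \<in> ?T"
    then show "C \<in> {?L, ?M}" using loop_eqI[of C D S] by blast
  next
    fix C assume "C \<in> {?L, ?M}"
    moreover have "?L \<in> loops D S" "?M \<in> loops D S"
      using end_edges_in_edges[OF D i(1)] by (intro loop_at_in_loops; simp)+
    ultimately show "C \<in> ?T" by blast
  qed
  finally show ?thesis .
qed

lemma nonsplit_connected:
  assumes ns: "nonsplit D" and D: "diagram_code D" and "u \<in> edges D" "v \<in> edges D"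
  shows "(u, v) \<in> conn (\<Union>x\<in>set (crossings D). fst ` set (ends x) \<times> fst ` set (ends x))"
proof -
  let ?R = "\<Union>x\<in>set (crossings D). fst ` set (ends x) \<times> fst ` set (ends x)"
  have "same_link D D" by (simp add: same_link_def)
  then have "card (components D) \<le> 1" using ns unfolding nonsplit_def by force
  moreover have c: "components D = cls ?R ` edges D" unfolding components_def classes_alt ..
  moreover have "finite (components D)" using D by (simp add: c diagram_code_def)
  ultimately have "cls ?R u = cls ?R v"
    using assms(3,4) by (metis (no_types, lifting) One_nat_def card_le_Suc0_iff_eq imageI)
  then show ?thesis by (simp only: cls_eq_iff)
qed

text \<open>For a connected diagram, the state graph is connected.\<close>

lemma walk_exists:
  assumes ns: "nonsplit D" and D: "diagram_code D"
    and L: "L \<in> loops D (all_one D)" and M: "M \<in> loops D (all_one D)"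
  shows "\<exists>is. state_graph_walk D (all_one D) L is M"
proof -
  let ?S = "all_one D"
  obtain u v where u: "u \<in> edges D" "L = loop_at D ?S u" and v: "v \<in> edges D" "M = loop_at D ?S v"
    using L M by (auto simp: loops_alt)
  let ?R = "\<Union>x\<in>set (crossings D). fst ` set (ends x) \<times> fst ` set (ends x)"
  have "(u, v) \<in> conn ?R" using nonsplit_connected[OF ns D u(1) v(1)] .
  then have "\<exists>is. state_graph_walk D ?S (loop_at D ?S u) is (loop_at D ?S v)"
  proof induction
    case base
    show ?case using loop_at_in_loops[OF u(1)] state_graph_walk.intros(1) by blast
  next
    case (step v w)
    then obtain x where x: "x \<in> set (crossings D)" "v \<in> fst ` set (ends x)" "w \<in> fst ` set (ends x)"
      by blast
    then obtain i where i: "i < length (crossings D)"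
      and vw: "v \<in> fst ` set (ends (crossings D ! i))" "w \<in> fst ` set (ends (crossings D ! i))"
      unfolding in_set_conv_nth[of x] by blast
    let ?e = "end_edge (crossings D ! i)"
    have iS: "i \<in> ?S" using i by (simp add: all_one_def)
    have "smoothing True (crossings D ! i) \<subseteq> joins D ?S"
      using i iS unfolding joins_def by force
    then have "(?e 0, ?e 3) \<in> conn (joins D ?S)" "(?e 1, ?e 2) \<in> conn (joins D ?S)"
      by (auto simp: smoothing_simps)
    then have eq: "loop_at D ?S (?e 3) = loop_at D ?S (?e 0)" "loop_at D ?S (?e 2) = loop_at D ?S (?e 1)"
      by (metis cls_eq_iff)+
    note t = trace_all_one_smoothed[OF D i iS]
    have mem: "loop_at D ?S v \<in> trace D ?S i" "loop_at D ?S w \<in> trace D ?S i"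
      using vw unfolding fst_ends t using eq by auto
    have "\<exists>is. state_graph_walk D ?S (loop_at D ?S v) is (loop_at D ?S w)"
    proof (cases "loop_at D ?S v = loop_at D ?S w")
      case True
      then show ?thesis using mem(1) by (auto simp: trace_def intro!: exI[of _ "[]"] state_graph_walk.intros(1))
    next
      case False
      then have "trace D ?S i = {loop_at D ?S v, loop_at D ?S w}" using mem unfolding t by auto
      with i show ?thesis by (intro exI[of _ "[i]"] walk_single[THEN iffD2] conjI)
    qed
    with step.IH show ?case by (elim exE) (rule exI, rule walk_append)
  qed
  then show ?thesis using u v by simp
qed

text \<open>A proper 2-colouring of the state graph, by the parity of walks from a fixed loop.\<close>

lemma two_colouring:
  assumes ns: "nonsplit D" and D: "diagram_code D" and ev: "even_state D (all_one D)"
  obtains c :: "nat set \<Rightarrow> rat"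
  where "\<And>L. c L \<noteq> 0" and "\<And>i L M. \<lbrakk>i < length (crossings D); trace D (all_one D) i = {L, M}\<rbrakk> \<Longrightarrow> c M = - c L"
proof -
  let ?S = "all_one D" and ?W = "state_graph_walk D (all_one D)"
  obtain B where B: "B \<in> loops D ?S"
    using D by (auto simp: diagram_code_def loops_alt)
  define c :: "nat set \<Rightarrow> rat" where "c L = (if \<exists>is. ?W B is L \<and> even (length is) then 1 else - 1)" for L
  have c: "c L = (- 1) ^ length is" if "?W B is L" for L "is"
  proof -
    have "even (length is) \<longleftrightarrow> even (length js)" if "?W B js L" for js
      using even_closed_walk[OF ev walk_append[OF \<open>?W B is L\<close> walk_rev[OF that]]] by simp
    with \<open>?W B is L\<close> have "(\<exists>js. ?W B js L \<and> even (length js)) \<longleftrightarrow> even (length is)" by blast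
    then show ?thesis by (simp add: c_def uminus_power_if)
  qed
  show thesis
  proof
    show "c L \<noteq> 0" for L by (simp add: c_def)
    fix i L M assume i: "i < length (crossings D)" and t: "trace D ?S i = {L, M}"
    then have "L \<in> loops D ?S" by (auto simp: trace_def)
    then obtain "is" where w: "?W B is L" using walk_exists[OF ns D B] by blast
    with i t have "?W B (is @ [i]) M" by (intro walk_append[of _ _ _ _ L]) (simp_all add: walk_single)
    then show "c M = - c L" using c[OF w] c[of "is @ [i]" M] by simp
  qed
qed


section \<open>The differential\<close>

lemma lookup_kh_diff:
  "Poly_Mapping.lookup (kh_diff D x) \<beta> = (\<Sum>\<alpha>\<in>Poly_Mapping.keys x.
     Poly_Mapping.lookup x \<alpha> * Poly_Mapping.lookup (kh_diff_basis D \<alpha>) \<beta>)"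
  unfolding kh_diff_def lookup_sum by (intro sum.cong) (auto simp: map.rep_eq when_def)

lemma kh_diff_diff: "kh_diff D (x - y) = kh_diff D x - kh_diff D y"
proof (rule poly_mapping_eqI)
  fix \<beta>
  let ?K = "Poly_Mapping.keys x \<union> Poly_Mapping.keys y"
  have *: "Poly_Mapping.lookup (kh_diff D z) \<beta> = (\<Sum>\<alpha>\<in>?K.
     Poly_Mapping.lookup z \<alpha> * Poly_Mapping.lookup (kh_diff_basis D \<alpha>) \<beta>)"
    if "Poly_Mapping.keys z \<subseteq> ?K" for z
    unfolding lookup_kh_diff using that
    by (intro sum.mono_neutral_left) (auto simp: in_keys_iff)
  show "Poly_Mapping.lookup (kh_diff D (x - y)) \<beta> = Poly_Mapping.lookup (kh_diff D x - kh_diff D y) \<beta>"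
    using keys_diff[of x y]
    by (simp add: * lookup_minus left_diff_distrib sum_subtractf)
qed

lemma kh_diff_0 [simp]: "kh_diff D 0 = 0"
  by (simp add: kh_diff_def)

lemma kh_diff_single: "kh_diff D (Poly_Mapping.single \<alpha> c) = Poly_Mapping.map ((*) c) (kh_diff_basis D \<alpha>)"
  by (rule poly_mapping_eqI) (auto simp: lookup_kh_diff map.rep_eq when_def)

lemma chains_diff: "\<lbrakk>x \<in> chains D; y \<in> chains D\<rbrakk> \<Longrightarrow> x - y \<in> chains D"
  using keys_diff[of x y] by (auto simp: chains_def)

lemma zero_in_chains [simp]: "0 \<in> chains D"
  by (simp add: chains_def)

lemma boundariesI: "x \<in> chains D \<Longrightarrow> kh_diff D x \<in> boundaries D"
  by (simp add: boundaries_def)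

lemma boundaries_diff:
  assumes "x \<in> boundaries D" "y \<in> boundaries D" shows "x - y \<in> boundaries D"
proof -
  obtain x' y' where "x = kh_diff D x'" "y = kh_diff D y'" "x' \<in> chains D" "y' \<in> chains D"
    using assms by (auto simp: boundaries_def)
  then show ?thesis using boundariesI[OF chains_diff, of x' D y'] by (simp add: kh_diff_diff)
qed

lemma zero_in_boundaries [simp]: "0 \<in> boundaries D"
  using boundariesI[OF zero_in_chains, of D] by simp

lemma boundaries_uminus: "x \<in> boundaries D \<Longrightarrow> - x \<in> boundaries D"
  using boundaries_diff[OF zero_in_boundaries] by simp

lemma kh_class_eq_iff:
  assumes "z \<in> cycles D" "w \<in> cycles D"
  shows "kh_class D z = kh_class D w \<longleftrightarrow> z - w \<in> boundaries D"
proof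
  assume "kh_class D z = kh_class D w"
  moreover have "w \<in> kh_class D w" using assms by (simp add: kh_class_def homologous_def)
  ultimately have "w \<in> kh_class D z" by simp
  then show "z - w \<in> boundaries D" by (simp add: kh_class_def homologous_def)
next
  assume *: "z - w \<in> boundaries D"
  have "z - y \<in> boundaries D \<longleftrightarrow> w - y \<in> boundaries D" for y
    using boundaries_diff[OF _ *, of "z - y"] boundaries_diff[OF _ boundaries_uminus[OF *], of "w - y"]
    by (auto simp: algebra_simps)
  with assms show "kh_class D z = kh_class D w" by (auto simp: kh_class_def homologous_def)
qed

lemma finite_markings:
  assumes "diagram_code D" shows "finite (loops D S \<rightarrow>\<^sub>E (UNIV :: mark set))"
proof -
  have "(UNIV :: mark set) = {Plus, Minus}" using mark.exhaust by auto
  then show ?thesis using finite_loops[OF assms] by (metis finite.emptyI finite.insertI finite_PiE)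
qed

text \<open>The differential vanishes on the all-1 state, as this has no 0-smoothed crossing.\<close>

lemma kh_diff_basis_all_one: "kh_diff_basis D (all_one D, a) = 0"
  by (simp add: kh_diff_basis_def all_one_def)

lemma all_one_in_states: "all_one D \<in> states D"
  by (simp add: all_one_def states_def)

lemma basis_all_one_cycle:
  assumes "a \<in> loops D (all_one D) \<rightarrow>\<^sub>E UNIV"
  shows "state_cycle D (all_one D) (all_one D, a)" "basis (all_one D, a) \<in> cycles D"
    "- basis (all_one D, a) \<in> cycles D"
proof -
  have e: "(all_one D, a) \<in> enhanced_states D"
    using assms by (auto simp: enhanced_states_def all_one_in_states)
  have d: "kh_diff D (basis (all_one D, a)) = 0"
    by (rule poly_mapping_eqI) (simp add: lookup_kh_diff kh_diff_basis_all_one)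
  show "state_cycle D (all_one D) (all_one D, a)" using e d by (simp add: state_cycle_def)
  show c: "basis (all_one D, a) \<in> cycles D" using e d by (simp add: cycles_def chains_def)
  show "- basis (all_one D, a) \<in> cycles D"
    using c kh_diff_diff[of D 0] chains_diff[OF zero_in_chains] by (fastforce simp: cycles_def)
qed

text \<open>
  The component of the differential that ends in the all-1 state comes from the states with
  exactly one 0-smoothed crossing. If this is crossing \<open>i\<close>, then all \<open>i\<close> crossings before it are
  1-smoothed, and the sign is \<open>(- 1) ^ i\<close>.
\<close>

lemma kh_diff_basis_one_zero:
  assumes "i < length (crossings D)"
  shows "kh_diff_basis D (all_one D - {i}, a) =
    (\<Sum>b\<in>loops D (all_one D) \<rightarrow>\<^sub>E UNIV. Poly_Mapping.single (all_one D, b)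
       ((- 1) ^ i * of_bool (edge_entry D (all_one D - {i}) a (all_one D) b)))"
proof -
  have "{..<length (crossings D)} - (all_one D - {i}) = {i}" "insert i (all_one D - {i}) = all_one D"
    using assms by (auto simp: all_one_def)
  moreover have "{j \<in> all_one D - {i}. j < i} = {..<i}"
    using assms by (auto simp: all_one_def)
  ultimately show ?thesis by (simp add: kh_diff_basis_def)
qed

lemma lookup_kh_diff_basis_one_zero:
  assumes "diagram_code D" "i < length (crossings D)" "b \<in> loops D (all_one D) \<rightarrow>\<^sub>E UNIV"
  shows "Poly_Mapping.lookup (kh_diff_basis D (all_one D - {i}, a)) (all_one D, b) =
    (- 1) ^ i * of_bool (edge_entry D (all_one D - {i}) a (all_one D) b)"
  unfolding kh_diff_basis_one_zero[OF assms(2)] lookup_sum lookup_single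
  using finite_markings[OF assms(1), of "all_one D"] assms(3)
  by (simp add: when_def if_distrib sum.delta cong: if_cong)

lemma lookup_kh_diff_basis_other:
  assumes "S \<in> states D" "\<And>i. i < length (crossings D) \<Longrightarrow> S \<noteq> all_one D - {i}"
  shows "Poly_Mapping.lookup (kh_diff_basis D (S, a)) (all_one D, b) = 0"
proof -
  have "insert i S \<noteq> all_one D" if "i \<in> {..<length (crossings D)} - S" for i
    using assms that by fastforce
  then show ?thesis unfolding kh_diff_basis_def lookup_sum
    by (auto simp: lookup_sum lookup_single when_def intro!: sum.neutral)
qed

text \<open>
  A linear combination of coefficients at enhanced states based on the all-1 state vanishes on
  boundaries if it vanishes on the images of the states with one 0-smoothed crossing.
\<close>

lemma functional_boundary_eq_0:
  fixes c :: "'k \<Rightarrow> rat"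
  assumes edge: "\<And>i a. i < length (crossings D) \<Longrightarrow>
      (\<Sum>k\<in>A. c k * Poly_Mapping.lookup (kh_diff_basis D (all_one D - {i}, a)) (all_one D, m k)) = 0"
    and z: "z \<in> boundaries D"
  shows "(\<Sum>k\<in>A. c k * Poly_Mapping.lookup z (all_one D, m k)) = 0"
proof -
  obtain x where x: "z = kh_diff D x" "x \<in> chains D" using z by (auto simp: boundaries_def)
  have basis: "(\<Sum>k\<in>A. c k * Poly_Mapping.lookup (kh_diff_basis D \<alpha>) (all_one D, m k)) = 0"
    if "\<alpha> \<in> Poly_Mapping.keys x" for \<alpha>
  proof -
    obtain S a where \<alpha>: "\<alpha> = (S, a)" "S \<in> states D"
      using x(2) \<open>\<alpha> \<in> _\<close> by (auto simp: chains_def enhanced_states_def)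
    show ?thesis
    proof (cases "\<exists>i<length (crossings D). S = all_one D - {i}")
      case True
      then show ?thesis using edge \<alpha> by auto
    next
      case False
      then show ?thesis using lookup_kh_diff_basis_other[OF \<alpha>(2)] \<alpha>(1) by simp
    qed
  qed
  have "(\<Sum>k\<in>A. c k * Poly_Mapping.lookup z (all_one D, m k)) =
    (\<Sum>\<alpha>\<in>Poly_Mapping.keys x. Poly_Mapping.lookup x \<alpha> *
      (\<Sum>k\<in>A. c k * Poly_Mapping.lookup (kh_diff_basis D \<alpha>) (all_one D, m k)))"
    unfolding x(1) lookup_kh_diff sum_distrib_left by (subst sum.swap) (simp add: mult_ac)
  also have "\<dots> = 0" using basis by simp
  finally show ?thesis .
qed


section \<open>Edge maps into an even all-1 state\<close>

text \<open>
  In an even state no trace is a self-loop, so each edge map into the all-1 state splits a loop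
  \<open>L \<union> M\<close> into the two loops \<open>L\<close> and \<open>M\<close> joined by the trace.
\<close>

lemma edge_entry_all_one:
  assumes D: "diagram_code D" and i: "i < length (crossings D)" and ev: "even_state D (all_one D)"
  obtains L M where "L \<noteq> M" "trace D (all_one D) i = {L, M}" "L \<in> loops D (all_one D)" "M \<in> loops D (all_one D)"
    "loops D (all_one D - {i}) = insert (L \<union> M) (loops D (all_one D) - {L, M})"
    "\<And>a b. edge_entry D (all_one D - {i}) a (all_one D) b \<longleftrightarrow>
      (\<forall>K\<in>loops D (all_one D) - {L, M}. a K = b K) \<and>
      (a (L \<union> M), b L, b M) \<in> {(Plus, Plus, Minus), (Plus, Minus, Plus), (Minus, Minus, Minus)}"
proof -
  let ?S = "all_one D" and ?e = "end_edge (crossings D ! i)"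
  define L where "L = loop_at D ?S (?e 0)"
  define M where "M = loop_at D ?S (?e 1)"
  have iS: "i \<in> ?S" using i by (simp add: all_one_def)
  have t: "trace D ?S i = {L, M}" unfolding L_def M_def by (rule trace_all_one_smoothed[OF D i iS])
  have ne: "L \<noteq> M"
  proof
    assume "L = M"
    then have "circuit D ?S [i]" using t i unfolding circuit_def by (auto simp: walk_single)
    then show False using ev by (auto simp: even_state_def)
  qed
  have in_loops: "L \<in> loops D ?S" "M \<in> loops D ?S"
    unfolding L_def M_def using loop_at_in_loops end_edges_in_edges[OF D i] by blast+
  have lo: "loops D (?S - {i}) = insert (L \<union> M) (loops D ?S - {L, M})"
    unfolding L_def M_def by (rule loops_Diff_crossing[OF D i iS ne[unfolded L_def M_def]])
  have LM: "L \<union> M \<notin> loops D ?S"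
  proof
    assume *: "L \<union> M \<in> loops D ?S"
    have "?e 0 \<in> L" "?e 1 \<in> M" unfolding L_def M_def by auto
    then have "L \<union> M = L" "L \<union> M = M"
      using loops_disjoint[OF * in_loops(1)] loops_disjoint[OF * in_loops(2)] by blast+
    then show False using ne by simp
  qed
  have d: "loops D ?S - loops D (?S - {i}) = {L, M}" "loops D (?S - {i}) - loops D ?S = {L \<union> M}"
    "loops D (?S - {i}) \<inter> loops D ?S = loops D ?S - {L, M}"
    using LM in_loops unfolding lo by auto
  have "\<not> merge_entry D (?S - {i}) a ?S b" for a b
    using ne unfolding merge_entry_def d by (auto simp: doubleton_eq_iff)
  moreover have "split_entry D (?S - {i}) a ?S b \<longleftrightarrow>
      (a (L \<union> M), b L, b M) \<in> {(Plus, Plus, Minus), (Plus, Minus, Plus), (Minus, Minus, Minus)}" for a b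
    using ne unfolding split_entry_def d by (auto simp: doubleton_eq_iff)
  ultimately show thesis
    by (intro that[OF ne t in_loops lo]) (simp add: edge_entry_def d)
qed


section \<open>Homology classes based on the all-1 state\<close>

text \<open>The markings of the all-1 state by plus signs only, and with a minus sign at \<open>L\<close> only.\<close>

abbreviation plus_marking :: "diagram \<Rightarrow> nat set \<Rightarrow> mark" where
  "plus_marking D \<equiv> \<lambda>L\<in>loops D (all_one D). Plus"

abbreviation minus_marking :: "diagram \<Rightarrow> nat set \<Rightarrow> nat set \<Rightarrow> mark" where
  "minus_marking D L \<equiv> \<lambda>L'\<in>loops D (all_one D). if L' = L then Minus else Plus"

lemma minus_marking_neq:
  assumes "L \<in> loops D (all_one D)" "K \<noteq> L"
  shows "minus_marking D K \<noteq> minus_marking D L"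
proof
  assume "minus_marking D K = minus_marking D L"
  then have "minus_marking D K L = minus_marking D L L" by (rule fun_cong)
  then show False using assms by simp
qed

lemma minus_marking_neq_plus:
  assumes "L \<in> loops D (all_one D)" shows "minus_marking D L \<noteq> plus_marking D"
proof
  assume "minus_marking D L = plus_marking D"
  then have "minus_marking D L L = plus_marking D L" by (rule fun_cong)
  then show False using assms by simp
qed

text \<open>
  Every term of a split contains a minus sign, so the all-plus state does not occur in boundaries.
\<close>

lemma lookup_boundary_all_plus:
  assumes D: "diagram_code D" and ev: "even_state D (all_one D)" and z: "z \<in> boundaries D"
  shows "Poly_Mapping.lookup z (all_plus D (all_one D)) = 0"
proof -
  have "(\<Sum>k\<in>{()}. 1 * Poly_Mapping.lookup z (all_one D, plus_marking D)) = 0"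
  proof (rule functional_boundary_eq_0[OF _ z])
    fix i a assume i: "i < length (crossings D)"
    obtain L M where "L \<noteq> M" "trace D (all_one D) i = {L, M}"
      "L \<in> loops D (all_one D)" "M \<in> loops D (all_one D)"
      "loops D (all_one D - {i}) = insert (L \<union> M) (loops D (all_one D) - {L, M})"
      "\<And>a b. edge_entry D (all_one D - {i}) a (all_one D) b \<longleftrightarrow>
      (\<forall>K\<in>loops D (all_one D) - {L, M}. a K = b K) \<and>
      (a (L \<union> M), b L, b M) \<in> {(Plus, Plus, Minus), (Plus, Minus, Plus), (Minus, Minus, Minus)}"
      by (rule edge_entry_all_one[OF D i ev]) (rule that)
    then have "\<not> edge_entry D (all_one D - {i}) a (all_one D) (plus_marking D)" by simp
    then show "(\<Sum>k\<in>{()}. 1 *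
        Poly_Mapping.lookup (kh_diff_basis D (all_one D - {i}, a)) (all_one D, plus_marking D)) = 0"
      using lookup_kh_diff_basis_one_zero[OF D i] by simp
  qed
  then show ?thesis by (simp add: all_plus_def)
qed

text \<open>
  The states with a single minus sign occur in boundaries in pairs of adjacent loops with equal
  coefficients, so the alternating sum of their coefficients vanishes.
\<close>

lemma alternating_sum_boundary:
  fixes c :: "nat set \<Rightarrow> rat"
  assumes D: "diagram_code D" and ev: "even_state D (all_one D)" and z: "z \<in> boundaries D"
    and c: "\<And>i L M. \<lbrakk>i < length (crossings D); trace D (all_one D) i = {L, M}\<rbrakk> \<Longrightarrow> c M = - c L"
  shows "(\<Sum>K\<in>loops D (all_one D). c K * Poly_Mapping.lookup z (one_minus D (all_one D) K)) = 0"
proof -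
  let ?m = "minus_marking D" and ?Lo = "loops D (all_one D)"
  have "(\<Sum>K\<in>?Lo. c K * Poly_Mapping.lookup z (all_one D, ?m K)) = 0"
  proof (rule functional_boundary_eq_0[OF _ z])
    fix i a assume i: "i < length (crossings D)"
    obtain L M where LM: "L \<noteq> M" "trace D (all_one D) i = {L, M}" "L \<in> ?Lo" "M \<in> ?Lo"
        "loops D (all_one D - {i}) = insert (L \<union> M) (?Lo - {L, M})"
      and e: "\<And>a b. edge_entry D (all_one D - {i}) a (all_one D) b \<longleftrightarrow>
      (\<forall>K\<in>?Lo - {L, M}. a K = b K) \<and>
      (a (L \<union> M), b L, b M) \<in> {(Plus, Plus, Minus), (Plus, Minus, Plus), (Minus, Minus, Minus)}"
      by (rule edge_entry_all_one[OF D i ev]) (rule that)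
    define g where "g K = Poly_Mapping.lookup (kh_diff_basis D (all_one D - {i}, a)) (all_one D, ?m K)" for K
    have g: "g K = (- 1) ^ i * of_bool (edge_entry D (all_one D - {i}) a (all_one D) (?m K))" for K
      unfolding g_def by (rule lookup_kh_diff_basis_one_zero[OF D i]) simp
    have "g K = 0" if "K \<notin> {L, M}" for K
      using that LM unfolding g e by auto
    then have "(\<Sum>K\<in>?Lo. c K * g K) = (\<Sum>K\<in>{L, M}. c K * g K)"
      using LM finite_loops[OF D] by (intro sum.mono_neutral_right) auto
    also have "\<dots> = c L * g L + c M * g M" using LM by simp
    also have "g L = g M"
      using LM unfolding g e by (auto simp: of_bool_def)
    also have "c L * g M + c M * g M = 0" using c[OF i LM(2)] by simp
    finally show "(\<Sum>K\<in>?Lo. c K *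
        Poly_Mapping.lookup (kh_diff_basis D (all_one D - {i}, a)) (all_one D, ?m K)) = 0"
      unfolding g_def .
  qed
  then show ?thesis by (simp add: one_minus_def)
qed

text \<open>
  The differential of the all-plus marking of the state with one 0-smoothed crossing is, up to
  sign, the sum of the two markings with a minus sign at one of the loops joined by the trace.
\<close>

lemma one_minus_adjacent:
  assumes D: "diagram_code D" and ev: "even_state D (all_one D)"
    and i: "i < length (crossings D)" and t: "trace D (all_one D) i = {L, M}"
  shows "basis (one_minus D (all_one D) L) + basis (one_minus D (all_one D) M) \<in> boundaries D"
proof -
  let ?S = "all_one D" and ?m = "minus_marking D"
  obtain L' M' where LM': "L' \<noteq> M'" "trace D ?S i = {L', M'}" "L' \<in> loops D ?S" "M' \<in> loops D ?S"
    and lo: "loops D (?S - {i}) = insert (L' \<union> M') (loops D ?S - {L', M'})"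
    and e: "\<And>a b. edge_entry D (?S - {i}) a ?S b \<longleftrightarrow>
      (\<forall>K\<in>loops D ?S - {L', M'}. a K = b K) \<and>
      (a (L' \<union> M'), b L', b M') \<in> {(Plus, Plus, Minus), (Plus, Minus, Plus), (Minus, Minus, Minus)}"
    by (rule edge_entry_all_one[OF D i ev]) (rule that)
  define a where "a = (\<lambda>K\<in>loops D (?S - {i}). Plus)"
  have aP: "a K = Plus" if "K \<in> loops D ?S - {L', M'} \<or> K = L' \<union> M'" for K
    using that by (auto simp: a_def lo)
  have entry: "edge_entry D (?S - {i}) a ?S b \<longleftrightarrow> b \<in> {?m L', ?m M'}"
    if b: "b \<in> loops D ?S \<rightarrow>\<^sub>E UNIV" for b
  proof
    assume "edge_entry D (?S - {i}) a ?S b"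
    then have "\<forall>K\<in>loops D ?S - {L', M'}. b K = Plus"
      and "b L' = Plus \<and> b M' = Minus \<or> b L' = Minus \<and> b M' = Plus"
      using aP unfolding e by auto
    moreover have "b K = undefined" if "K \<notin> loops D ?S" for K
      using PiE_arb[OF b that] .
    ultimately have "b = ?m L' \<or> b = ?m M'"
      using LM'(1,3,4) by (elim disjE conjE) (auto simp: fun_eq_iff restrict_def)
    then show "b \<in> {?m L', ?m M'}" by simp
  next
    assume b: "b \<in> {?m L', ?m M'}"
    have "a (L' \<union> M') = Plus" "\<forall>K\<in>loops D ?S - {L', M'}. a K = Plus" using aP by blast+
    with b LM'(1,3,4) show "edge_entry D (?S - {i}) a ?S b"
      unfolding e by (elim insertE emptyE) simp_all
  qed
  have ne: "?m L' \<noteq> ?m M'"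
    using LM'(1,4) by (rule minus_marking_neq[rotated])
  have "kh_diff_basis D (?S - {i}, a) =
      (\<Sum>b\<in>{?m L', ?m M'}. Poly_Mapping.single (?S, b) ((- 1) ^ i))"
    unfolding kh_diff_basis_one_zero[OF i] using entry finite_markings[OF D, of ?S]
    by (intro sum.mono_neutral_cong_right) auto
  also have "\<dots> = Poly_Mapping.single (?S, ?m L') ((- 1) ^ i) + Poly_Mapping.single (?S, ?m M') ((- 1) ^ i)"
    using ne by simp
  \<comment> \<open>The coefficient cancels the sign of the edge map.\<close>
  finally have "kh_diff D (Poly_Mapping.single (?S - {i}, a) ((- 1) ^ i)) =
      basis (one_minus D ?S L') + basis (one_minus D ?S M')"
    by (intro poly_mapping_eqI)
      (auto simp: kh_diff_single map.rep_eq one_minus_def lookup_add lookup_single when_def)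
  moreover have "Poly_Mapping.single (?S - {i}, a) ((- 1) ^ i) \<in> chains D"
    by (auto simp: chains_def enhanced_states_def states_def all_one_def a_def)
  ultimately have "basis (one_minus D ?S L') + basis (one_minus D ?S M') \<in> boundaries D"
    using boundariesI by metis
  moreover have "L = L' \<and> M = M' \<or> L = M' \<and> M = L'"
    using t LM'(2) by (auto simp: doubleton_eq_iff)
  ultimately show ?thesis by (auto simp: add.commute)
qed

lemma one_minus_walk:
  assumes D: "diagram_code D" and ev: "even_state D (all_one D)"
  shows "state_graph_walk D (all_one D) L is M \<Longrightarrow>
    basis (one_minus D (all_one D) L) - basis (one_minus D (all_one D) M) \<in> boundaries D \<or>
    basis (one_minus D (all_one D) L) + basis (one_minus D (all_one D) M) \<in> boundaries D"
proof (induction rule: state_graph_walk.induct)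
  case (1 L)
  then show ?case by simp
next
  case (2 i L L' "is" L'')
  let ?B = "\<lambda>K. basis (one_minus D (all_one D) K)"
  have "?B L + ?B L' - (?B L' - ?B L'') = ?B L + ?B L''"
    and "?B L + ?B L' - (?B L' + ?B L'') = ?B L - ?B L''" by simp_all
  then show ?case
    using 2(4) boundaries_diff[OF one_minus_adjacent[OF D ev 2(1,2)]] by metis
qed

theorem theorem3p1:
  fixes D :: diagram and \<sigma> :: state
  assumes "link_diagram D" and "nonsplit D"
    and "\<sigma> = all_one D" and "even_state D \<sigma>"
  shows "(state_cycle D \<sigma> (all_plus D \<sigma>) \<and> nontrivial D (all_plus D \<sigma>) \<and>
      (\<forall>\<beta>. state_cycle D \<sigma> \<beta> \<and>
           kh_class D (basis \<beta>) = kh_class D (basis (all_plus D \<sigma>)) \<longrightarrow> \<beta> = all_plus D \<sigma>)) \<and>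
    (\<forall>L \<in> loops D \<sigma>. state_cycle D \<sigma> (one_minus D \<sigma> L) \<and> nontrivial D (one_minus D \<sigma> L)) \<and>
    (\<forall>L \<in> loops D \<sigma>. \<forall>L' \<in> loops D \<sigma>.
      kh_class D (basis (one_minus D \<sigma> L)) = kh_class D (basis (one_minus D \<sigma> L')) \<or>
      kh_class D (basis (one_minus D \<sigma> L)) = kh_class D (- basis (one_minus D \<sigma> L'))) \<and>
    loops D \<sigma> \<noteq> {} \<and>
    (\<forall>L \<in> loops D \<sigma>.
      kh_class D (basis (one_minus D \<sigma> L)) \<noteq> kh_class D (basis (all_plus D \<sigma>)))"
proof -
  have D: "diagram_code D" using assms(1) by (simp add: link_diagram_def)
  have ev: "even_state D (all_one D)" using assms by simp
  have zero: "0 \<in> cycles D" by (simp add: cycles_def)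
  have plus: "state_cycle D \<sigma> (all_plus D \<sigma>)" "basis (all_plus D \<sigma>) \<in> cycles D"
    unfolding all_plus_def assms(3) by (intro basis_all_one_cycle; simp)+
  have minus: "state_cycle D \<sigma> (one_minus D \<sigma> L)" "basis (one_minus D \<sigma> L) \<in> cycles D"
    "- basis (one_minus D \<sigma> L) \<in> cycles D" for L
    unfolding one_minus_def assms(3) by (intro basis_all_one_cycle; simp)+
  have nt_plus: "nontrivial D (all_plus D \<sigma>)"
    using lookup_boundary_all_plus[OF D ev] assms(3)
    unfolding nontrivial_def kh_class_eq_iff[OF plus(2) zero] by fastforce
  have unique: "\<beta> = all_plus D \<sigma>"
    if "basis \<beta> \<in> cycles D" "kh_class D (basis \<beta>) = kh_class D (basis (all_plus D \<sigma>))" for \<beta>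
  proof (rule ccontr)
    assume "\<beta> \<noteq> all_plus D \<sigma>"
    moreover have "basis \<beta> - basis (all_plus D \<sigma>) \<in> boundaries D"
      using that kh_class_eq_iff[OF _ plus(2)] by blast
    ultimately show False
      using lookup_boundary_all_plus[OF D ev] assms(3) by (fastforce simp: lookup_minus lookup_single)
  qed
  have nt_minus: "nontrivial D (one_minus D \<sigma> L)" if L: "L \<in> loops D \<sigma>" for L
  proof -
    obtain c :: "nat set \<Rightarrow> rat" where c: "\<And>L. c L \<noteq> 0"
      "\<And>i L M. \<lbrakk>i < length (crossings D); trace D (all_one D) i = {L, M}\<rbrakk> \<Longrightarrow> c M = - c L"
      using two_colouring[OF assms(2) D ev] by metis
    have "one_minus D \<sigma> K \<noteq> one_minus D \<sigma> L" if "K \<noteq> L" for K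
      using minus_marking_neq[OF L[unfolded assms(3)] that] by (simp add: one_minus_def assms(3))
    then have "one_minus D \<sigma> L = one_minus D \<sigma> K \<longleftrightarrow> K = L" for K
      by metis
    then have "c K * Poly_Mapping.lookup (basis (one_minus D \<sigma> L)) (one_minus D \<sigma> K) =
        (if K = L then c L else 0)" for K
      by (simp add: lookup_single when_def)
    then have "(\<Sum>K\<in>loops D \<sigma>. c K * Poly_Mapping.lookup (basis (one_minus D \<sigma> L)) (one_minus D \<sigma> K)) = c L"
      using L finite_loops[OF D] by simp
    moreover have "(\<Sum>K\<in>loops D \<sigma>. c K * Poly_Mapping.lookup z (one_minus D \<sigma> K)) = 0"
      if "z \<in> boundaries D" for z
      unfolding assms(3) using alternating_sum_boundary[OF D ev that, of c] c(2) by blast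
    ultimately have "basis (one_minus D \<sigma> L) \<notin> boundaries D"
      using c(1)[of L] by fastforce
    then show ?thesis unfolding nontrivial_def kh_class_eq_iff[OF minus(2) zero] by simp
  qed
  have same: "kh_class D (basis (one_minus D \<sigma> L)) = kh_class D (basis (one_minus D \<sigma> L')) \<or>
      kh_class D (basis (one_minus D \<sigma> L)) = kh_class D (- basis (one_minus D \<sigma> L'))"
    if "L \<in> loops D \<sigma>" "L' \<in> loops D \<sigma>" for L L'
  proof -
    obtain "is" where "state_graph_walk D (all_one D) L is L'"
      using walk_exists[OF assms(2) D] \<open>L \<in> _\<close> \<open>L' \<in> _\<close> assms(3) by blast
    from one_minus_walk[OF D ev this] show ?thesis
      unfolding kh_class_eq_iff[OF minus(2) minus(2)] kh_class_eq_iff[OF minus(2) minus(3)]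
      by (simp add: assms(3))
  qed
  have "one_minus D \<sigma> L \<noteq> all_plus D \<sigma>" if "L \<in> loops D \<sigma>" for L
    using minus_marking_neq_plus that by (simp add: one_minus_def all_plus_def assms(3))
  moreover have "loops D \<sigma> \<noteq> {}" using D by (auto simp: diagram_code_def loops_alt)
  moreover have "basis \<beta> \<in> cycles D" if "state_cycle D \<sigma> \<beta>" for \<beta>
    using that by (simp add: state_cycle_def cycles_def chains_def)
  ultimately show ?thesis
    using plus(1) nt_plus unique minus(1,2) nt_minus same by blast
qed

end
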